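(* The class $(\mathrm{Y})$ of Yosida $\ell$-groups is not a radical class.
   Context: $\ell$-group means lattice-ordered group (written additively). For $a\in G$, $G(a)=\{b\in G:|b|\le n|a|\text{ for some }n\in\mathbb{N}\}$ is the principal convex $\ell$-subgroup generated by $a$. $G\in(\mathrm{Y})$ ($G$ is a Yosida $\ell$-group) means that the frame of convex $\ell$-subgroups of $G$ is a Yosida frame, i.e. for every $a\in G$, $G(a)$ is an intersection of maximal (proper) convex $\ell$-subgroups of $G$ (the empty intersection being $G$). A class $\mathcal{R}$ of $\ell$-groups is a radical class if it is nonempty, closed under isomorphic images, closed under convex $\ell$-subgroups, and closed under joins of convex $\ell$-subgroups: whenever $G$ is an $\ell$-group and $(A_\lambda)_{\lambda\in\Lambda}$ is a family of convex $\ell$-subgroups of $G$ each belonging to $\mathcal{R}$, the join $\bigvee_\lambda A_\lambda$ in the lattice of convex $\ell$-subgroups of $G$ belongs to $\mathcal{R}$. *)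

theory Defs
  imports Complex_Main "HOL-Library.Equipollence" "HOL-Algebra.Group"
begin

text \<open>
  Lattice-ordered groups, not necessarily abelian. HOL-Algebra writes arbitrary groups
  multiplicatively, so the additive \<open>a + b\<close>, \<open>- a\<close>, \<open>n a\<close> become \<open>a \<otimes> b\<close>, \<open>inv a\<close>,
  \<open>a [^] n\<close>. Carriers are explicit because convex subgroups must themselves count as
  lattice-ordered groups.
\<close>

record 'a lgroup = "'a monoid" +
  leq :: "'a \<Rightarrow> 'a \<Rightarrow> bool" (infix \<open>\<preceq>\<index>\<close> 50)

definition order_reduct :: "('a, 'm) lgroup_scheme \<Rightarrow> 'a gorder" where
  "order_reduct G = \<lparr>carrier = carrier G, eq = (=), le = leq G\<rparr>"

locale l_group = group G for G :: "('a, 'm) lgroup_scheme" (structure) +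
  assumes lattice_order: "Lattice.lattice (order_reduct G)"
    and mult_left_mono: "\<lbrakk>a \<in> carrier G; b \<in> carrier G; c \<in> carrier G; a \<preceq> b\<rbrakk> \<Longrightarrow> c \<otimes> a \<preceq> c \<otimes> b"
    and mult_right_mono: "\<lbrakk>a \<in> carrier G; b \<in> carrier G; c \<in> carrier G; a \<preceq> b\<rbrakk> \<Longrightarrow> a \<otimes> c \<preceq> b \<otimes> c"

definition lg_join :: "('a, 'm) lgroup_scheme \<Rightarrow> 'a \<Rightarrow> 'a \<Rightarrow> 'a" where
  "lg_join G a b = a \<squnion>\<^bsub>order_reduct G\<^esub> b"

definition lg_meet :: "('a, 'm) lgroup_scheme \<Rightarrow> 'a \<Rightarrow> 'a \<Rightarrow> 'a" where
  "lg_meet G a b = a \<sqinter>\<^bsub>order_reduct G\<^esub> b"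

definition lg_abs :: "('a, 'm) lgroup_scheme \<Rightarrow> 'a \<Rightarrow> 'a" where
  "lg_abs G a = lg_join G a (inv\<^bsub>G\<^esub> a)"

definition lg_iso :: "('a, 'm) lgroup_scheme \<Rightarrow> ('b, 'n) lgroup_scheme \<Rightarrow> ('a \<Rightarrow> 'b) set" where
  "lg_iso G H = {h \<in> iso G H. \<forall>a\<in>carrier G. \<forall>b\<in>carrier G.
     h (lg_join G a b) = lg_join H (h a) (h b) \<and> h (lg_meet G a b) = lg_meet H (h a) (h b)}"

definition convex_lsubgroup :: "'a set \<Rightarrow> ('a, 'm) lgroup_scheme \<Rightarrow> bool" where
  "convex_lsubgroup H G \<longleftrightarrow>
     subgroup H G \<and>
     (\<forall>a\<in>H. \<forall>b\<in>H. lg_join G a b \<in> H \<and> lg_meet G a b \<in> H) \<and>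
     (\<forall>a\<in>H. \<forall>b\<in>H. \<forall>x\<in>carrier G. a \<preceq>\<^bsub>G\<^esub> x \<and> x \<preceq>\<^bsub>G\<^esub> b \<longrightarrow> x \<in> H)"

definition convex_lattice :: "('a, 'm) lgroup_scheme \<Rightarrow> 'a set gorder" where
  "convex_lattice G = \<lparr>carrier = {H. convex_lsubgroup H G}, eq = (=), le = (\<subseteq>)\<rparr>"

definition principal_convex :: "('a, 'm) lgroup_scheme \<Rightarrow> 'a \<Rightarrow> 'a set" where
  "principal_convex G a =
     {b \<in> carrier G. \<exists>n::nat. lg_abs G b \<preceq>\<^bsub>G\<^esub> lg_abs G a [^]\<^bsub>G\<^esub> n}"

definition maximal_convex_lsubgroup :: "'a set \<Rightarrow> ('a, 'm) lgroup_scheme \<Rightarrow> bool" where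
  "maximal_convex_lsubgroup M G \<longleftrightarrow>
     convex_lsubgroup M G \<and> M \<noteq> carrier G \<and>
     (\<forall>K. convex_lsubgroup K G \<and> M \<subseteq> K \<longrightarrow> K = M \<or> K = carrier G)"

text \<open>Intersecting with \<open>carrier G\<close> makes the empty intersection equal to \<open>G\<close>.\<close>

definition yosida_lgroup :: "('a, 'm) lgroup_scheme \<Rightarrow> bool" where
  "yosida_lgroup G \<longleftrightarrow>
     l_group G \<and>
     (\<forall>a\<in>carrier G. \<exists>\<M>. (\<forall>M\<in>\<M>. maximal_convex_lsubgroup M G) \<and>
        principal_convex G a = carrier G \<inter> \<Inter>\<M>)"

text \<open>
  HOL has no proper classes, so a class of lattice-ordered groups is taken relative to the
  universe of all those whose carrier is a subset of the type \<open>'a\<close>.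
\<close>

definition radical_class :: "'a lgroup set \<Rightarrow> bool" where
  "radical_class \<R> \<longleftrightarrow>
     (\<forall>G\<in>\<R>. l_group G) \<and>
     \<R> \<noteq> {} \<and>
     (\<forall>G\<in>\<R>. \<forall>H. l_group H \<and> lg_iso G H \<noteq> {} \<longrightarrow> H \<in> \<R>) \<and>
     (\<forall>G\<in>\<R>. \<forall>A. convex_lsubgroup A G \<longrightarrow> G\<lparr>carrier := A\<rparr> \<in> \<R>) \<and>
     (\<forall>G \<A>. l_group G \<and> (\<forall>A\<in>\<A>. convex_lsubgroup A G \<and> G\<lparr>carrier := A\<rparr> \<in> \<R>) \<longrightarrow>
        G\<lparr>carrier := \<Squnion>\<^bsub>convex_lattice G\<^esub> \<A>\<rparr> \<in> \<R>)"

definition yosida_class :: "'a lgroup set" where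
  "yosida_class = {G. yosida_lgroup G}"

end

(*
  Consider integer-valued locally constant functions on the Cantor space of bit sequences, and
  allow them logarithmic poles: near x the function may look like c + n * v(x, y), where v(x, y)
  is the length of the common prefix of x and y. The value at x itself is the germ c + n * T with
  T infinitely large, so that the order stays pointwise.

  For a single point p, the functions whose only pole is at p form a Yosida l-group: its maximal
  convex l-subgroups "the value at y is 0" (y different from p) and "no pole at p" suffice,
  because two functions are comparable near each point and the Cantor space is compact.

  The join of all these convex l-subgroups is not Yosida: a proper convex l-subgroup M missing the
  constant 1 has a common zero x by compactness. But then M lies strictly inside the functions
  without pole at x, which contain 1, and these are still proper; so M is not maximal. Hence
  every maximal convex l-subgroup contains 1, and {0} is not an intersection of maximal ones.
*)

theory Submission
  imports Defs "HOL-Computational_Algebra.Polynomial" "HOL-Analysis.Abstract_Topology_2"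
begin

section \<open>Lattice-ordered groups of functions\<close>

text \<open>
  The elements are coded by an arbitrary type \<open>'a\<close>, with \<open>ev\<close> decoding them to functions, since the
  example has to live inside the type given in the theorem.
\<close>

locale fun_lgroup =
  fixes G :: "('a, 'm) lgroup_scheme" (structure)
    and ev :: "'a \<Rightarrow> 'x \<Rightarrow> 'v::linordered_idom"
  assumes ev_inject: "\<lbrakk>a \<in> carrier G; b \<in> carrier G; ev a = ev b\<rbrakk> \<Longrightarrow> a = b"
    and mult_closed: "\<lbrakk>a \<in> carrier G; b \<in> carrier G\<rbrakk> \<Longrightarrow> a \<otimes> b \<in> carrier G"
    and ev_mult: "\<lbrakk>a \<in> carrier G; b \<in> carrier G\<rbrakk> \<Longrightarrow> ev (a \<otimes> b) = (\<lambda>x. ev a x + ev b x)"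
    and unit_closed: "\<one> \<in> carrier G"
    and ev_one: "ev \<one> = (\<lambda>x. 0)"
    and uminus_exists: "a \<in> carrier G \<Longrightarrow> \<exists>b\<in>carrier G. ev b = (\<lambda>x. - ev a x)"
    and max_exists: "\<lbrakk>a \<in> carrier G; b \<in> carrier G\<rbrakk> \<Longrightarrow> \<exists>c\<in>carrier G. ev c = (\<lambda>x. max (ev a x) (ev b x))"
    and leq_iff: "\<lbrakk>a \<in> carrier G; b \<in> carrier G\<rbrakk> \<Longrightarrow> a \<preceq> b \<longleftrightarrow> (\<forall>x. ev a x \<le> ev b x)"
begin

section \<open>Pointwise group and lattice operations\<close>

lemma group: "group G"
proof (rule groupI)
  show "x \<otimes> y \<otimes> z = x \<otimes> (y \<otimes> z)" if "x \<in> carrier G" "y \<in> carrier G" "z \<in> carrier G" for x y z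
    using that by (intro ev_inject) (simp_all add: mult_closed ev_mult add.assoc)
  show "\<one> \<otimes> x = x" if "x \<in> carrier G" for x
    using that by (intro ev_inject) (simp_all add: mult_closed ev_mult unit_closed ev_one)
  show "\<exists>y\<in>carrier G. y \<otimes> x = \<one>" if "x \<in> carrier G" for x
  proof -
    obtain b where b: "b \<in> carrier G" "ev b = (\<lambda>t. - ev x t)"
      using uminus_exists \<open>x \<in> carrier G\<close> by blast
    have "b \<otimes> x = \<one>"
      using b that by (intro ev_inject) (simp_all add: mult_closed ev_mult unit_closed ev_one)
    with b show ?thesis by blast
  qed
qed (simp_all add: mult_closed unit_closed)

sublocale group G by (rule group)

lemma ev_inv: "a \<in> carrier G \<Longrightarrow> ev (inv a) = (\<lambda>x. - ev a x)"
proof -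
  assume a: "a \<in> carrier G"
  have "(\<lambda>x. ev (inv a) x + ev a x) = (\<lambda>x. 0)"
    using ev_mult[of "inv a" a] a by (simp add: ev_one)
  then show ?thesis by (simp add: fun_eq_iff eq_neg_iff_add_eq_0)
qed

lemma ev_pow: "a \<in> carrier G \<Longrightarrow> ev (a [^] (n::nat)) = (\<lambda>x. of_nat n * ev a x)"
  by (induction n) (simp_all add: ev_one ev_mult fun_eq_iff algebra_simps)

lemma least_upper:
  assumes "a \<in> carrier G" "b \<in> carrier G" "c \<in> carrier G" "ev c = (\<lambda>x. max (ev a x) (ev b x))"
  shows "least (order_reduct G) c (Upper (order_reduct G) {a, b})"
  using assms by (auto simp: least_def Upper_def order_reduct_def leq_iff)

lemma greatest_lower:
  assumes "a \<in> carrier G" "b \<in> carrier G" "c \<in> carrier G" "ev c = (\<lambda>x. min (ev a x) (ev b x))"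
  shows "greatest (order_reduct G) c (Lower (order_reduct G) {a, b})"
  using assms by (auto simp: greatest_def Lower_def order_reduct_def leq_iff)

lemma min_exists:
  assumes a: "a \<in> carrier G" and b: "b \<in> carrier G"
  shows "\<exists>c\<in>carrier G. ev c = (\<lambda>x. min (ev a x) (ev b x))"
proof -
  obtain d where d: "d \<in> carrier G" "ev d = (\<lambda>x. max (ev (inv a) x) (ev (inv b) x))"
    using max_exists[of "inv a" "inv b"] a b by auto
  have "ev (inv d) = (\<lambda>x. min (ev a x) (ev b x))"
    using a b d by (simp add: ev_inv fun_eq_iff minus_max_eq_min)
  with d show ?thesis by (meson inv_closed)
qed

lemma lattice: "Lattice.lattice (order_reduct G)"
proof
  fix a b assume ab: "a \<in> carrier (order_reduct G)" "b \<in> carrier (order_reduct G)"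
  then have "a \<in> carrier G" "b \<in> carrier G"
    by (simp_all add: order_reduct_def)
  then show "\<exists>s. least (order_reduct G) s (Upper (order_reduct G) {a, b})"
    and "\<exists>s. greatest (order_reduct G) s (Lower (order_reduct G) {a, b})"
    using max_exists least_upper min_exists greatest_lower by metis+
next
  fix a b
  assume "a \<sqsubseteq>\<^bsub>order_reduct G\<^esub> b" "b \<sqsubseteq>\<^bsub>order_reduct G\<^esub> a"
    and "a \<in> carrier (order_reduct G)" "b \<in> carrier (order_reduct G)"
  then show "a .=\<^bsub>order_reduct G\<^esub> b"
    by (simp add: order_reduct_def leq_iff) (intro ev_inject ext order.antisym; simp)
next
  fix a b c
  assume "a \<sqsubseteq>\<^bsub>order_reduct G\<^esub> b" "b \<sqsubseteq>\<^bsub>order_reduct G\<^esub> c"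
    and "a \<in> carrier (order_reduct G)" "b \<in> carrier (order_reduct G)" "c \<in> carrier (order_reduct G)"
  then show "a \<sqsubseteq>\<^bsub>order_reduct G\<^esub> c"
    by (auto simp: order_reduct_def leq_iff intro: order_trans)
qed (auto simp: order_reduct_def leq_iff)

sublocale l_group G
  by (intro l_group.intro l_group_axioms.intro group lattice) (auto simp: leq_iff ev_mult)

text \<open>\<open>lg_join\<close> is a choice of some least upper bound; antisymmetry leaves the
  pointwise maximum as the only candidate.\<close>

lemma join_props:
  assumes a: "a \<in> carrier G" and b: "b \<in> carrier G"
  shows lg_join_closed: "lg_join G a b \<in> carrier G"
    and ev_join: "ev (lg_join G a b) = (\<lambda>x. max (ev a x) (ev b x))"
proof -
  interpret L: Lattice.lattice "order_reduct G" by (rule lattice)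
  obtain c where c: "c \<in> carrier G" "ev c = (\<lambda>x. max (ev a x) (ev b x))"
    using max_exists a b by blast
  have "lg_join G a b = c"
    unfolding lg_join_def join_def sup_def
    using least_upper[OF a b c] by (rule some_equality) (metis L.least_unique least_upper[OF a b c])
  with c show "lg_join G a b \<in> carrier G" "ev (lg_join G a b) = (\<lambda>x. max (ev a x) (ev b x))"
    by simp_all
qed

lemma meet_props:
  assumes a: "a \<in> carrier G" and b: "b \<in> carrier G"
  shows lg_meet_closed: "lg_meet G a b \<in> carrier G"
    and ev_meet: "ev (lg_meet G a b) = (\<lambda>x. min (ev a x) (ev b x))"
proof -
  interpret L: Lattice.lattice "order_reduct G" by (rule lattice)
  obtain c where c: "c \<in> carrier G" "ev c = (\<lambda>x. min (ev a x) (ev b x))"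
    using min_exists a b by blast
  have "lg_meet G a b = c"
    unfolding lg_meet_def meet_def inf_def
    using greatest_lower[OF a b c] by (rule some_equality) (metis L.greatest_unique greatest_lower[OF a b c])
  with c show "lg_meet G a b \<in> carrier G" "ev (lg_meet G a b) = (\<lambda>x. min (ev a x) (ev b x))"
    by simp_all
qed

lemma lg_abs_closed: "a \<in> carrier G \<Longrightarrow> lg_abs G a \<in> carrier G"
  by (simp add: lg_abs_def lg_join_closed)

lemma ev_abs: "a \<in> carrier G \<Longrightarrow> ev (lg_abs G a) = (\<lambda>x. \<bar>ev a x\<bar>)"
  by (auto simp: lg_abs_def ev_join ev_inv fun_eq_iff abs_if max_def)

lemma principal_convex_eq:
  assumes "a \<in> carrier G"
  shows "principal_convex G a = {b \<in> carrier G. \<exists>n::nat. \<forall>x. \<bar>ev b x\<bar> \<le> of_nat n * \<bar>ev a x\<bar>}"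
  using assms unfolding principal_convex_def
  by (intro Collect_cong conj_cong refl) (simp add: leq_iff lg_abs_closed ev_abs ev_pow)

section \<open>Convex l-subgroups: a solidity criterion, maximal kernels, joins\<close>

lemma convex_lsubgroupI:
  assumes sub: "H \<subseteq> carrier G" and one: "\<one> \<in> H"
    and diff: "\<And>a b. \<lbrakk>a \<in> H; b \<in> H\<rbrakk> \<Longrightarrow> a \<otimes> inv b \<in> H"
    and solid: "\<And>a b. \<lbrakk>a \<in> H; b \<in> carrier G; \<And>x. \<bar>ev b x\<bar> \<le> \<bar>ev a x\<bar>\<rbrakk> \<Longrightarrow> b \<in> H"
  shows "convex_lsubgroup H G"
proof -
  have inv: "inv a \<in> H" if "a \<in> H" for a
    using diff[OF one that] that sub by auto
  have mult: "a \<otimes> b \<in> H" if "a \<in> H" "b \<in> H" for a b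
    using diff[OF that(1) inv[OF that(2)]] that sub by auto
  have abs: "lg_abs G a \<in> H" if "a \<in> H" for a
  proof -
    have "a \<in> carrier G" using that sub by auto
    then show ?thesis by (intro solid[OF that]) (simp_all add: lg_abs_closed ev_abs)
  qed
  have sandwich: "x \<in> H" if "a \<in> H" "b \<in> H" "x \<in> carrier G" "a \<preceq> x" "x \<preceq> b" for a b x
  proof (rule solid)
    \<comment> \<open>The sum of the absolute values of \<open>a\<close> and \<open>b\<close>
      dominates everything between \<open>a\<close> and \<open>b\<close>, and likewise their join
      and meet; so solidity yields both order convexity and lattice closure.\<close>
    show "lg_abs G a \<otimes> lg_abs G b \<in> H" using that by (intro mult abs)
    fix t
    have "ev a t \<le> ev x t" "ev x t \<le> ev b t" using that sub by (auto simp: leq_iff)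
    then show "\<bar>ev x t\<bar> \<le> \<bar>ev (lg_abs G a \<otimes> lg_abs G b) t\<bar>"
      using that sub by (auto simp: ev_mult lg_abs_closed ev_abs subset_iff)
  qed (use that in auto)
  have lat: "lg_join G a b \<in> H \<and> lg_meet G a b \<in> H" if "a \<in> H" "b \<in> H" for a b
  proof -
    have "lg_abs G a \<otimes> lg_abs G b \<in> H" using that by (intro mult abs)
    moreover have "\<bar>ev (lg_join G a b) t\<bar> \<le> \<bar>ev (lg_abs G a \<otimes> lg_abs G b) t\<bar>"
      "\<bar>ev (lg_meet G a b) t\<bar> \<le> \<bar>ev (lg_abs G a \<otimes> lg_abs G b) t\<bar>" for t
      using that sub by (auto simp: ev_mult ev_join ev_meet lg_abs_closed ev_abs subset_iff max_def min_def)
    ultimately show ?thesis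
      using that sub by (meson solid subsetD lg_join_closed lg_meet_closed)
  qed
  have "subgroup H G"
    using sub one inv mult by unfold_locales auto
  then show ?thesis
    unfolding convex_lsubgroup_def by (intro conjI ballI impI) (use lat sandwich in blast)+
qed

text \<open>The image of \<open>h\<close> is a nonzero subgroup of the integers, which is
  archimedean and so has no proper nonzero convex subgroup. This is the source of all maximal convex
  l-subgroups in the example.\<close>

lemma kernel_maximal:
  fixes h :: "'a \<Rightarrow> int"
  assumes h_mult: "\<And>a b. \<lbrakk>a \<in> carrier G; b \<in> carrier G\<rbrakk> \<Longrightarrow> h (a \<otimes> b) = h a + h b"
    and h_join: "\<And>a b. \<lbrakk>a \<in> carrier G; b \<in> carrier G\<rbrakk> \<Longrightarrow> h (lg_join G a b) = max (h a) (h b)"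
    and nonzero: "c \<in> carrier G" "h c \<noteq> 0"
  shows "maximal_convex_lsubgroup {a \<in> carrier G. h a = 0} G"
proof -
  let ?N = "{a \<in> carrier G. h a = 0}"
  have h_one: "h \<one> = 0" using h_mult[of \<one> \<one>] by simp
  have h_inv: "h (inv a) = - h a" if "a \<in> carrier G" for a
    using h_mult[of "inv a" a] that h_one by simp
  have h_pow: "h (a [^] n) = int n * h a" if "a \<in> carrier G" for a and n :: nat
    by (induction n) (use that in \<open>simp_all add: h_one h_mult algebra_simps\<close>)
  have h_mono: "h a \<le> h b" if "a \<in> carrier G" "b \<in> carrier G" "\<And>x. ev a x \<le> ev b x" for a b
  proof -
    have "lg_join G a b = b"
      using that by (intro ev_inject) (auto simp: lg_join_closed ev_join fun_eq_iff max_absorb2)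
    then show ?thesis using h_join[of a b] that by simp
  qed
  have h_abs: "h (lg_abs G a) = \<bar>h a\<bar>" if "a \<in> carrier G" for a
    using that by (auto simp: lg_abs_def h_join h_inv)
  have "convex_lsubgroup ?N G"
  proof (rule convex_lsubgroupI)
    fix a b assume ab: "a \<in> ?N" "b \<in> carrier G" "\<And>x. \<bar>ev b x\<bar> \<le> \<bar>ev a x\<bar>"
    have "h (lg_abs G b) \<le> h (lg_abs G a)"
      using ab by (intro h_mono) (auto simp: lg_abs_closed ev_abs)
    then show "b \<in> ?N" using ab by (simp add: h_abs)
  qed (auto simp: h_one h_mult h_inv)
  moreover have "?N \<noteq> carrier G" using nonzero by auto
  moreover have "K = carrier G" if K: "convex_lsubgroup K G" and sub: "?N \<subseteq> K" and neq: "K \<noteq> ?N" for K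
  proof -
    interpret K: subgroup K G using K by (simp add: convex_lsubgroup_def)
    obtain k0 where k0: "k0 \<in> K" "h k0 \<noteq> 0" using sub neq K.subset by blast
    obtain k where k: "k \<in> K" "h k > 0"
    proof (cases "h k0 > 0")
      case False
      then show ?thesis using k0 by (intro that[of "inv k0"]) (auto simp: h_inv)
    qed (use k0 that in auto)
    have upper: "\<exists>u\<in>K. g \<preceq> u" if g: "g \<in> carrier G" for g
    proof -
      define n where "n = nat (h g)"
      have kn: "k [^] n \<in> K" using k(1) by (induction n) auto
      \<comment> \<open>The excess of \<open>g\<close> over \<open>n\<close> copies of
        \<open>k\<close>. Since \<open>h k\<close> is at least 1 and \<open>n\<close> at least
        \<open>h g\<close>, its image under \<open>h\<close> is 0, so it lies in the kernel; adding
        the copies of \<open>k\<close> back gives an upper bound of \<open>g\<close> in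
        \<open>K\<close>.\<close>
      let ?u = "lg_join G \<one> (g \<otimes> inv (k [^] n))"
      have "int n \<le> int n * h k"
        using k(2) ordered_semiring_class.mult_left_mono[of 1 "h k" "int n"] by simp
      moreover have "h g \<le> int n" by (simp add: n_def)
      ultimately have "h g \<le> int n * h k" by linarith
      then have "h ?u = 0"
        using g k K.subset by (auto simp: h_join h_one h_mult h_inv h_pow subset_iff)
      then have "?u \<in> K" using sub g kn K.subset by (auto simp: lg_join_closed subset_iff)
      then have "?u \<otimes> k [^] n \<in> K" using kn by simp
      moreover have "g \<preceq> ?u \<otimes> k [^] n"
        using g kn K.subset
        by (auto simp: leq_iff ev_mult ev_inv ev_join ev_one lg_join_closed subset_iff max_def)
      ultimately show ?thesis by blast
    qed
    have "g \<in> K" if g: "g \<in> carrier G" for g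
    proof -
      obtain u where u: "u \<in> K" "g \<preceq> u" using upper[OF g] by blast
      obtain w where w: "w \<in> K" "inv g \<preceq> w" using upper[of "inv g"] g by auto
      have "inv w \<preceq> g"
        using w g K.subset by (auto simp: leq_iff ev_inv subset_iff minus_le_iff)
      with u w g K show ?thesis by (meson convex_lsubgroup_def K.m_inv_closed)
    qed
    then show ?thesis using K.subset by auto
  qed
  ultimately show ?thesis unfolding maximal_convex_lsubgroup_def by blast
qed

lemma convex_lsubgroup_carrier: "convex_lsubgroup (carrier G) G"
  by (rule convex_lsubgroupI) auto

text \<open>Makes every fact of this locale available again inside a convex l-subgroup, with the
  same decoding.\<close>

lemma sub_lgroup:
  assumes "convex_lsubgroup A G"
  shows "fun_lgroup (G\<lparr>carrier := A\<rparr>) ev"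
proof -
  interpret A: subgroup A G using assms by (simp add: convex_lsubgroup_def)
  have "\<exists>b\<in>A. ev b = (\<lambda>x. - ev a x)" if "a \<in> A" for a
    using that by (intro bexI[of _ "inv a"]) (auto simp: ev_inv)
  moreover have "\<exists>c\<in>A. ev c = (\<lambda>x. max (ev a x) (ev b x))" if "a \<in> A" "b \<in> A" for a b
  proof
    show "lg_join G a b \<in> A"
      using assms that unfolding convex_lsubgroup_def by blast
  qed (use that in \<open>simp add: ev_join\<close>)
  moreover have "a = b" if "a \<in> A" "b \<in> A" "ev a = ev b" for a b
    using that by (intro ev_inject) auto
  moreover have "a \<preceq> b \<longleftrightarrow> (\<forall>x. ev a x \<le> ev b x)" if "a \<in> A" "b \<in> A" for a b
    using that by (intro leq_iff) auto
  ultimately show ?thesis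
    by (intro fun_lgroup.intro) (simp_all add: ev_mult ev_one)
qed

lemma convex_lsubgroup_Inter:
  assumes "\<H> \<noteq> {}" "\<And>H. H \<in> \<H> \<Longrightarrow> convex_lsubgroup H G"
  shows "convex_lsubgroup (\<Inter>\<H>) G"
proof -
  have "subgroup (\<Inter>\<H>) G"
    using assms by (intro subgroups_Inter) (auto simp: convex_lsubgroup_def)
  with assms(2) show ?thesis
    unfolding convex_lsubgroup_def by (simp add: Ball_def Inter_iff) meson
qed

lemma convex_join:
  assumes \<A>: "\<And>A. A \<in> \<A> \<Longrightarrow> convex_lsubgroup A G"
  shows "convex_lsubgroup (\<Squnion>\<^bsub>convex_lattice G\<^esub> \<A>) G"
    and "A \<in> \<A> \<Longrightarrow> A \<subseteq> \<Squnion>\<^bsub>convex_lattice G\<^esub> \<A>"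
proof -
  let ?\<H> = "{H. convex_lsubgroup H G \<and> \<Union>\<A> \<subseteq> H}"
  have "\<Union>\<A> \<subseteq> carrier G" using \<A> subgroup.subset unfolding convex_lsubgroup_def by fast
  \<comment> \<open>The supremum is a choice of some least upper bound, so one has to be exhibited
    first. The family is nonempty because it contains the whole carrier.\<close>
  then have "convex_lsubgroup (\<Inter>?\<H>) G"
    using convex_lsubgroup_carrier by (intro convex_lsubgroup_Inter) auto
  then have "least (convex_lattice G) (\<Inter>?\<H>) (Upper (convex_lattice G) \<A>)"
    using \<A> by (auto simp: least_def Upper_def convex_lattice_def)
  then have "least (convex_lattice G) (\<Squnion>\<^bsub>convex_lattice G\<^esub> \<A>) (Upper (convex_lattice G) \<A>)"
    unfolding sup_def by (rule someI)
  then have up: "\<Squnion>\<^bsub>convex_lattice G\<^esub> \<A> \<in> Upper (convex_lattice G) \<A>"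
    by (rule least_mem)
  then show "convex_lsubgroup (\<Squnion>\<^bsub>convex_lattice G\<^esub> \<A>) G"
    by (simp add: Upper_def convex_lattice_def)
  show "A \<subseteq> \<Squnion>\<^bsub>convex_lattice G\<^esub> \<A>" if "A \<in> \<A>"
    using up that \<A> by (auto simp: Upper_def convex_lattice_def)
qed

end


section \<open>The order on integer polynomials\<close>

text \<open>Links the formal order to values at large integers. A nonzero tail of value at least 1
  contributes at least \<open>n\<close>, which outweighs the constant coefficient; for constants the
  bound 1 is integrality.\<close>

lemma pos_poly_eventually_ge_1:
  "pos_poly (p :: int poly) \<Longrightarrow> \<forall>\<^sub>F n in sequentially. 1 \<le> poly p (int n)"
proof (induction p)
  case (pCons a p)
  show ?case
  proof (cases "p = 0")
    case False
    then have "\<forall>\<^sub>F n in sequentially. 1 \<le> poly p (int n)"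
      using pCons by (simp add: pos_poly_pCons)
    moreover have "\<forall>\<^sub>F n in sequentially. 1 - a \<le> int n"
      using eventually_ge_at_top[of "nat (1 - a)"] by eventually_elim auto
    ultimately show ?thesis
    proof eventually_elim
      case (elim n)
      have "int n * 1 \<le> int n * poly p (int n)"
        using elim(1) by (rule mult_left_mono) simp
      with elim show ?case by simp
    qed
  qed (use pCons.prems in \<open>simp add: pos_poly_pCons\<close>)
qed simp

lemma poly_eventually_mono:
  assumes "p \<le> (q :: int poly)"
  shows "\<forall>\<^sub>F n in sequentially. poly p (int n) \<le> poly q (int n)"
proof (cases "p = q")
  case False
  then have "pos_poly (q - p)" using assms by (simp add: less_eq_poly_def)
  from pos_poly_eventually_ge_1[OF this] show ?thesis
    by eventually_elim simp
qed simp

text \<open>A difference that vanishes eventually is neither positive nor negative. Hence a germ is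
  determined by its values at large integers.\<close>

lemma poly_eqI_eventually:
  assumes "\<forall>\<^sub>F n in sequentially. poly p (int n) = poly q (int n)"
  shows "p = q"
proof -
  have "\<not> pos_poly r" if "\<forall>\<^sub>F n in sequentially. poly r (int n) = 0" for r :: "int poly"
  proof
    assume "pos_poly r"
    from pos_poly_eventually_ge_1[OF this] that have "\<forall>\<^sub>F n in sequentially. False"
      by eventually_elim simp
    then show False by simp
  qed
  from this[of "p - q"] this[of "- (p - q)"] assms have "\<not> pos_poly (p - q)" "\<not> pos_poly (- (p - q))"
    by (simp_all add: eventually_mono)
  with pos_poly_total[of "p - q"] show ?thesis by simp
qed

lemma poly_max_eventually:
  "\<forall>\<^sub>F n in sequentially. poly (max p q) (int n) = max (poly p (int n)) (poly q (int n))"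
proof (cases "p \<le> q")
  case True
  from poly_eventually_mono[OF this] show ?thesis
    by eventually_elim (simp add: True max_absorb2)
next
  case False
  then have "q \<le> p" by simp
  from poly_eventually_mono[OF this] show ?thesis
    by eventually_elim (simp add: \<open>q \<le> p\<close> max_absorb1)
qed

section \<open>Top coefficients, degrees and absolute values\<close>

lemma coeff_mono_top:
  assumes "u \<le> (v :: int poly)" "degree u \<le> k" "degree v \<le> k"
  shows "coeff u k \<le> coeff v k"
proof (cases "u = v")
  case False
  then have pos: "0 < lead_coeff (v - u)" using assms(1) by (simp add: less_eq_poly_def pos_poly_def)
  have "degree (v - u) \<le> k" using assms by (simp add: degree_diff_le)
  then have "0 \<le> coeff (v - u) k"
    using pos by (cases "degree (v - u) = k") (auto simp: coeff_eq_0 simp del: coeff_diff)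
  then show ?thesis by simp
qed simp

text \<open>With additivity, this makes the coefficient at \<open>k\<close> a join-preserving
  homomorphism to the integers on degrees up to \<open>k\<close>, as \<open>kernel_maximal\<close>
  requires.\<close>

lemma coeff_max_top:
  assumes "degree u \<le> k" "degree v \<le> k"
  shows "coeff (max u v) k = max (coeff u k) (coeff (v :: int poly) k)"
  using coeff_mono_top[of u v k] coeff_mono_top[of v u k] assms by (auto simp: max_def)

lemma abs_poly_cases: "\<bar>p :: int poly\<bar> = p \<or> \<bar>p\<bar> = - p"
  by (simp add: abs_poly_def)

lemma degree_abs_poly [simp]: "degree \<bar>p :: int poly\<bar> = degree p"
  using abs_poly_cases[of p] by auto

lemma coeff_abs_top:
  assumes "degree (u :: int poly) \<le> k"
  shows "coeff \<bar>u\<bar> k = \<bar>coeff u k\<bar>"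
proof -
  have "\<bar>u\<bar> = max u (- u)" by (simp add: max_def abs_if)
  with assms show ?thesis by (simp add: coeff_max_top)
qed

lemma degree_lowered:
  assumes "degree p \<le> Suc 0" "coeff p (Suc 0) = 0"
  shows "degree p = 0"
proof (rule ccontr)
  assume nz: "degree p \<noteq> 0"
  then have "degree p = Suc 0" using assms(1) by simp
  then have "lead_coeff p = 0" using assms(2) by simp
  with nz show False by simp
qed

lemma less_poly_top:
  assumes "degree u \<le> k" "degree v \<le> k" "coeff u k < coeff (v :: int poly) k"
  shows "u < v"
proof -
  have "0 < coeff (v - u) k" using assms by simp
  moreover have "degree (v - u) \<le> k" using assms by (simp add: degree_diff_le)
  moreover have "k \<le> degree (v - u)" using calculation(1) by (intro le_degree) simp
  ultimately show ?thesis by (simp add: less_poly_def pos_poly_def)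
qed

text \<open>A higher degree means an infinitely larger absolute value. This is why absence of a pole
  is a convex condition.\<close>

lemma degree_mono_abs:
  assumes "\<bar>u\<bar> \<le> \<bar>v :: int poly\<bar>"
  shows "degree u \<le> degree v"
proof (rule ccontr)
  assume less: "\<not> degree u \<le> degree v"
  then have "u \<noteq> 0" by auto
  have "\<bar>v\<bar> < \<bar>u\<bar>"
    using less \<open>u \<noteq> 0\<close> by (intro less_poly_top[of _ "degree u"]) (auto simp: coeff_abs_top coeff_eq_0)
  with assms show False by simp
qed

text \<open>Constants reduce to integers, and nonconstant polynomials are infinitely large in
  absolute value.\<close>

lemma one_le_abs_poly:
  assumes "u \<noteq> (0 :: int poly)"
  shows "1 \<le> \<bar>u\<bar>"
proof (cases "degree u = 0")
  case True
  then obtain c where "u = [:c:]" by (rule degree_eq_zeroE)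
  then have "u = of_int c" by (simp add: of_int_poly)
  moreover from this have "1 \<le> \<bar>c\<bar>" using assms by auto
  ultimately show ?thesis by (metis of_int_1_le_iff of_int_abs)
next
  case False
  then have "1 < \<bar>u\<bar>"
    using assms by (intro less_poly_top[of _ "degree u"]) (auto simp: coeff_abs_top coeff_eq_0)
  then show ?thesis by simp
qed

text \<open>The integer \<open>coeff v k\<close> has absolute value at least 1, so any
  \<open>n\<close> exceeding the absolute value of \<open>coeff u k\<close> already wins in the
  coefficient at \<open>k\<close>.\<close>

lemma archimedean_top:
  assumes "degree u \<le> k" "degree v \<le> k" "coeff (v :: int poly) k \<noteq> 0"
  shows "\<exists>n::nat. \<bar>u\<bar> \<le> of_nat n * \<bar>v\<bar>"
proof -
  define n where "n = nat (\<bar>coeff u k\<bar> + 1)"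
  have "degree (of_nat n * \<bar>v\<bar>) \<le> k"
    using degree_mult_le[of "of_nat n" "\<bar>v\<bar>"] assms(2) by simp
  moreover have "coeff (of_nat n * \<bar>v\<bar>) k = int n * \<bar>coeff v k\<bar>"
    using assms(2) by (simp add: of_nat_poly coeff_abs_top)
  moreover have "int n * 1 \<le> int n * \<bar>coeff v k\<bar>"
    using assms(3) by (intro mult_left_mono) auto
  moreover have "\<bar>coeff u k\<bar> < int n" by (simp add: n_def)
  ultimately have "\<bar>u\<bar> < of_nat n * \<bar>v\<bar>"
    using assms(1) by (intro less_poly_top[of _ k]) (auto simp: coeff_abs_top)
  then show ?thesis using order.strict_implies_order by blast
qed

section \<open>Compactness of the Cantor space\<close>

lemma cantor_compactness:
  fixes P :: "(nat \<Rightarrow> bool) set \<Rightarrow> bool"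
  assumes local: "\<And>x. \<exists>n. P {y. \<forall>i<n. y i = x i}"
    and union: "\<And>A B. \<lbrakk>P A; P B\<rbrakk> \<Longrightarrow> P (A \<union> B)"
  shows "P UNIV"
proof (rule ccontr)
  assume not_UNIV: "\<not> P UNIV"
  define C where "C = (\<lambda>(x :: nat \<Rightarrow> bool) n. {y. \<forall>i<n. y i = x i})"
  have "\<exists>z. \<forall>n. \<not> P (C (z n) n) \<and> (\<forall>i<n. z (Suc n) i = z n i)"
  proof (rule dependent_nat_choice)
    show "\<exists>x. \<not> P (C x 0)" using not_UNIV by (simp add: C_def)
    fix x n assume bad: "\<not> P (C x n)"
    \<comment> \<open>A cylinder is the union of its two halves, so failure of \<open>P\<close> is
      inherited by one of them; repeated halving shrinks to a point where the local hypothesis is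
      violated.\<close>
    have "C x n = C x (Suc n) \<union> C (x(n := \<not> x n)) (Suc n)"
      by (auto simp: C_def less_Suc_eq)
    with bad union have "\<not> P (C x (Suc n)) \<or> \<not> P (C (x(n := \<not> x n)) (Suc n))"
      by metis
    then show "\<exists>y. \<not> P (C y (Suc n)) \<and> (\<forall>i<n. y i = x i)"
      by (elim disjE; force)
  qed
  then obtain z where z: "\<And>n. \<not> P (C (z n) n)" "\<And>n i. i < n \<Longrightarrow> z (Suc n) i = z n i"
    by blast
  \<comment> \<open>Bit \<open>i\<close> no longer changes from stage \<open>Suc i\<close> on, so
    this is the limit point of the nested cylinders.\<close>
  define x where "x = (\<lambda>i. z (Suc i) i)"
  have "z n i = x i" if "i < n" for n i
    using that
  proof (induction n)
    case (Suc n)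
    then show ?case by (cases "i = n") (simp_all add: x_def z(2))
  qed simp
  then have "C (z n) n = C x n" for n by (auto simp: C_def)
  with z(1) local[of x] show False by (auto simp: C_def)
qed

section \<open>Functions with poles on the Cantor space\<close>

text \<open>The common prefix has length exactly \<open>n\<close>. A relation avoids assigning a
  length when \<open>y = x\<close>; for fixed \<open>x\<close> the annuli partition all other
  points.\<close>

definition splits_at :: "(nat \<Rightarrow> bool) \<Rightarrow> nat \<Rightarrow> (nat \<Rightarrow> bool) \<Rightarrow> bool" where
  "splits_at x n y \<longleftrightarrow> (\<forall>i<n. y i = x i) \<and> y n \<noteq> x n"

lemma splits_at_exists: "y \<noteq> x \<Longrightarrow> \<exists>n. splits_at x n y"
proof -
  assume "y \<noteq> x"
  then have "\<exists>n. y n \<noteq> x n" by auto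
  then have "splits_at x (LEAST n. y n \<noteq> x n) y"
    unfolding splits_at_def by (intro conjI allI impI) (blast dest: not_less_Least, rule LeastI_ex)
  then show ?thesis ..
qed

lemma Least_splits_at: "splits_at x n y \<Longrightarrow> (LEAST i. y i \<noteq> x i) = n"
  unfolding splits_at_def by (intro Least_equality) (auto intro: leI)

lemma splits_at_trans: "\<lbrakk>splits_at p k x; splits_at x n y; k < n\<rbrakk> \<Longrightarrow> splits_at p k y"
  by (auto simp: splits_at_def)

text \<open>
  The germ \<open>c + n T\<close> is the polynomial \<open>[:c, n:]\<close>; the order on \<^typ>\<open>int poly\<close> makes the
  variable infinitely large. Values away from poles are constant polynomials.
\<close>

definition pole_funs :: "((nat \<Rightarrow> bool) \<Rightarrow> int poly) set" where
  "pole_funs = {g. \<forall>x. degree (g x) \<le> 1 \<and>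
     (\<forall>\<^sub>F n in sequentially. \<forall>y. splits_at x n y \<longrightarrow> g y = of_int (poly (g x) (int n)))}"

lemma pole_funs_degree: "g \<in> pole_funs \<Longrightarrow> degree (g x) \<le> 1"
  by (simp add: pole_funs_def)

lemma pole_funs_germ:
  "g \<in> pole_funs \<Longrightarrow>
    \<forall>\<^sub>F n in sequentially. \<forall>y. splits_at x n y \<longrightarrow> g y = of_int (poly (g x) (int n))"
  by (simp add: pole_funs_def)

lemma pole_funsI:
  assumes "\<And>x. degree (g x) \<le> 1"
    and "\<And>x. \<forall>\<^sub>F n in sequentially. \<forall>y. splits_at x n y \<longrightarrow> g y = of_int (poly (g x) (int n))"
  shows "g \<in> pole_funs"
  using assms by (simp add: pole_funs_def)

lemma const_pole_funs: "(\<lambda>x. of_int c) \<in> pole_funs"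
  by (rule pole_funsI) (simp_all add: of_int_poly)

lemma add_pole_funs:
  assumes "f \<in> pole_funs" "g \<in> pole_funs"
  shows "(\<lambda>x. f x + g x) \<in> pole_funs"
proof (rule pole_funsI)
  fix x
  show "degree (f x + g x) \<le> 1"
    using assms by (intro degree_add_le pole_funs_degree)
  show "\<forall>\<^sub>F n in sequentially. \<forall>y. splits_at x n y \<longrightarrow> f y + g y = of_int (poly (f x + g x) (int n))"
    using assms[THEN pole_funs_germ, of x] by eventually_elim simp
qed

lemma uminus_pole_funs:
  assumes "f \<in> pole_funs"
  shows "(\<lambda>x. - f x) \<in> pole_funs"
proof (rule pole_funsI)
  fix x
  show "degree (- f x) \<le> 1"
    using pole_funs_degree[OF assms] by simp
  show "\<forall>\<^sub>F n in sequentially. \<forall>y. splits_at x n y \<longrightarrow> - f y = of_int (poly (- f x) (int n))"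
    using assms[THEN pole_funs_germ, of x] by eventually_elim simp
qed

lemma max_pole_funs:
  assumes "f \<in> pole_funs" "g \<in> pole_funs"
  shows "(\<lambda>x. max (f x) (g x)) \<in> pole_funs"
proof (rule pole_funsI)
  fix x
  show "degree (max (f x) (g x)) \<le> 1"
    using assms[THEN pole_funs_degree] by (simp add: max_def)
  show "\<forall>\<^sub>F n in sequentially.
      \<forall>y. splits_at x n y \<longrightarrow> max (f y) (g y) = of_int (poly (max (f x) (g x)) (int n))"
    using assms[THEN pole_funs_germ, of x] poly_max_eventually[of "f x" "g x"]
    by eventually_elim (simp add: of_int_max)
qed

text \<open>The length of the common prefix with \<open>p\<close>, completed at \<open>p\<close> by
  its germ, the infinitely large variable.\<close>

definition pole :: "(nat \<Rightarrow> bool) \<Rightarrow> (nat \<Rightarrow> bool) \<Rightarrow> int poly" where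
  "pole p y = (if y = p then [:0, 1:] else of_int (int (LEAST i. y i \<noteq> p i)))"

lemma pole_split: "splits_at p n y \<Longrightarrow> pole p y = of_int (int n)"
  using Least_splits_at[of p n y] by (auto simp: pole_def splits_at_def)

lemma degree_pole: "x \<noteq> p \<Longrightarrow> degree (pole p x) = 0"
  by (simp add: pole_def)

lemma pole_pole_funs: "pole p \<in> pole_funs"
proof (rule pole_funsI)
  fix x
  show "degree (pole p x) \<le> 1" by (simp add: pole_def)
  show "\<forall>\<^sub>F n in sequentially. \<forall>y. splits_at x n y \<longrightarrow> pole p y = of_int (poly (pole p x) (int n))"
  proof (cases "x = p")
    case True
    then have "poly (pole p x) (int n) = int n" for n by (simp add: pole_def)
    with True show ?thesis by (simp add: pole_split)
  next
    case False
    then obtain k where k: "splits_at p k x" using splits_at_exists by blast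
    show ?thesis
      \<comment> \<open>Points sharing more than \<open>k\<close> bits with \<open>x\<close> leave
        \<open>p\<close> at the same index as \<open>x\<close>, so the function is constant near
        \<open>x\<close>.\<close>
      using eventually_gt_at_top[of k]
    proof eventually_elim
      case (elim n)
      show ?case
        using pole_split[OF k] pole_split[OF splits_at_trans[OF k _ elim]] by (simp add: of_nat_poly)
    qed
  qed
qed

text \<open>An inequality of germs holds on all sufficiently small annuli, and at \<open>x\<close>
  by assumption. This turns pointwise comparisons into cylinder-wise ones, as compactness
  needs.\<close>

lemma pole_funs_local_mono:
  assumes f: "f \<in> pole_funs" and g: "g \<in> pole_funs" and le: "f x \<le> g x"
  shows "\<exists>n. \<forall>y. (\<forall>i<n. y i = x i) \<longrightarrow> f y \<le> g y"
proof -
  have "\<forall>\<^sub>F n in sequentially. \<forall>y. splits_at x n y \<longrightarrow> f y \<le> g y"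
    using pole_funs_germ[OF f, of x] pole_funs_germ[OF g, of x] poly_eventually_mono[OF le]
    by eventually_elim simp
  then obtain N where N: "\<And>n y. \<lbrakk>N \<le> n; splits_at x n y\<rbrakk> \<Longrightarrow> f y \<le> g y"
    by (auto simp: eventually_sequentially)
  have "f y \<le> g y" if "\<forall>i<N. y i = x i" for y
  proof (cases "y = x")
    case False
    then obtain n where n: "splits_at x n y" using splits_at_exists by blast
    with that have "N \<le> n" by (auto simp: splits_at_def intro: leI)
    with n show ?thesis by (rule N[rotated])
  qed (use le in simp)
  then show ?thesis by blast
qed

section \<open>Size of the function space: at most the continuum\<close>

lemma pole_funs_eqI:
  assumes f: "f \<in> pole_funs" and g: "g \<in> pole_funs"
    and eq: "\<And>y N. \<forall>n\<ge>N. \<not> y n \<Longrightarrow> f y = g y"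
  shows "f = g"
proof
  fix x
  have "\<forall>\<^sub>F n in sequentially. poly (f x) (int n) = poly (g x) (int n)"
    using pole_funs_germ[OF f, of x] pole_funs_germ[OF g, of x]
  proof eventually_elim
    case (elim n)
    \<comment> \<open>Bit \<open>n\<close> of \<open>x\<close> is flipped and followed by zeros:
      every annulus around \<open>x\<close> meets the eventually-zero sequences, so values there
      determine the germ at \<open>x\<close>.\<close>
    define y where "y = (\<lambda>i. if i < n then x i else i = n \<and> \<not> x n)"
    have "splits_at x n y" by (simp add: splits_at_def y_def)
    moreover have "f y = g y" by (rule eq[of "Suc n"]) (simp add: y_def)
    ultimately show ?case using elim by simp
  qed
  then show "f x = g x" by (rule poly_eqI_eventually)
qed

lemma pole_funs_lepoll: "pole_funs \<lesssim> (UNIV :: real set)"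
proof -
  \<comment> \<open>A function is determined by its values on the countable dense set of eventually-zero sequences.\<close>
  define pt where "pt = (\<lambda>(w :: bool list) i. i < length w \<and> w ! i)"
  \<comment> \<open>Pairing each value with its argument lets a mere set of naturals remember the
    function.\<close>
  define code where "code = (\<lambda>g. range (\<lambda>w. to_nat (w, coeffs (g (pt w) :: int poly))))"
  have "inj_on code pole_funs"
  proof (rule inj_onI)
    fix f g assume fg: "f \<in> pole_funs" "g \<in> pole_funs" and eq: "code f = code g"
    have pt_eq: "f (pt w) = g (pt w)" for w
    proof -
      have "to_nat (w, coeffs (f (pt w))) \<in> code g" using eq by (auto simp: code_def)
      then show ?thesis by (auto simp: code_def coeffs_eq_iff)
    qed
    show "f = g"
    proof (rule pole_funs_eqI[OF fg])
      fix y :: "nat \<Rightarrow> bool" and N assume "\<forall>n\<ge>N. \<not> y n"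
      then have "i < N" if "y i" for i using that leI by blast
      then have "pt (map y [0..<N]) = y" by (auto simp: pt_def fun_eq_iff)
      then show "f y = g y" using pt_eq by metis
    qed
  qed
  then have "pole_funs \<lesssim> (UNIV :: nat set set)" unfolding lepoll_def by blast
  also have "\<dots> \<lesssim> (UNIV :: real set)"
    using nat_sets_eqpoll_reals by (rule eqpoll_imp_lepoll)
  finally show ?thesis .
qed

section \<open>The counterexample\<close>

locale pole_lgroup = fun_lgroup G ev
  for G :: "('a, 'm) lgroup_scheme" (structure) and ev :: "'a \<Rightarrow> (nat \<Rightarrow> bool) \<Rightarrow> int poly" +
  assumes ev_image: "ev ` carrier G = pole_funs"
begin

lemma ev_pole_funs: "a \<in> carrier G \<Longrightarrow> ev a \<in> pole_funs"
  using ev_image by blast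

lemma ev_surj: "g \<in> pole_funs \<Longrightarrow> \<exists>a\<in>carrier G. ev a = g"
  using ev_image by (metis imageE)

section \<open>The subgroups with a single admissible pole are Yosida\<close>

definition one_pole :: "(nat \<Rightarrow> bool) \<Rightarrow> 'a set" where
  "one_pole p = {a \<in> carrier G. \<forall>x. x \<noteq> p \<longrightarrow> degree (ev a x) = 0}"

lemma convex_degree_0:
  "convex_lsubgroup {a \<in> carrier G. \<forall>x\<in>S. degree (ev a x) = 0} G"
proof (rule convex_lsubgroupI)
  let ?D = "{a \<in> carrier G. \<forall>x\<in>S. degree (ev a x) = 0}"
  show "a \<otimes> inv b \<in> ?D" if "a \<in> ?D" "b \<in> ?D" for a b
    using that degree_diff_le[of "ev a _" 0 "ev b _"] by (simp add: ev_mult ev_inv)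
  show "b \<in> ?D" if "a \<in> ?D" "b \<in> carrier G" "\<And>x. \<bar>ev b x\<bar> \<le> \<bar>ev a x\<bar>" for a b
  proof -
    have le: "degree (ev b x) \<le> degree (ev a x)" for x
      using that(3) by (rule degree_mono_abs)
    have "degree (ev b x) = 0" if "x \<in> S" for x
      using le[of x] \<open>a \<in> ?D\<close> \<open>x \<in> S\<close> by simp
    with \<open>b \<in> carrier G\<close> show ?thesis by simp
  qed
qed (simp_all add: ev_one subset_iff)

lemma convex_one_pole: "convex_lsubgroup (one_pole p) G"
  using convex_degree_0[of "- {p}"] by (simp add: one_pole_def Ball_def)

lemma yosida_one_pole: "yosida_lgroup (G\<lparr>carrier := one_pole p\<rparr>)"
proof -
  let ?A = "G\<lparr>carrier := one_pole p\<rparr>"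
  interpret A: fun_lgroup ?A ev
    using convex_one_pole by (rule sub_lgroup)
  have in_G: "a \<in> carrier G" if "a \<in> one_pole p" for a
    using that by (simp add: one_pole_def)
  \<comment> \<open>The degree of the leading germ at \<open>y\<close>: the pole order at \<open>p\<close>, the value elsewhere.\<close>
  define k where "k = (\<lambda>y. of_bool (y = p) :: nat)"
  define N where "N = (\<lambda>y. {b \<in> one_pole p. coeff (ev b y) (k y) = 0})"
  have deg: "degree (ev a y) \<le> k y" if "a \<in> one_pole p" for a y
    using that pole_funs_degree[OF ev_pole_funs[OF in_G[OF that]], of y]
    by (auto simp: one_pole_def k_def)
  have N_maximal: "maximal_convex_lsubgroup (N y) ?A" for y
  proof -
    \<comment> \<open>The coefficient map must not vanish identically: the pole itself witnesses
      this at \<open>p\<close>, the constant 1 elsewhere.\<close>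
    have "\<exists>c\<in>one_pole p. coeff (ev c y) (k y) \<noteq> 0"
    proof (cases "y = p")
      case True
      obtain c where c: "c \<in> carrier G" "ev c = pole p"
        using ev_surj[OF pole_pole_funs] by blast
      then have "c \<in> one_pole p" by (simp add: one_pole_def degree_pole)
      moreover have "coeff (ev c y) (k y) \<noteq> 0" using c True by (simp add: k_def pole_def)
      ultimately show ?thesis by blast
    next
      case False
      obtain c where c: "c \<in> carrier G" "ev c = (\<lambda>x. of_int 1)"
        using ev_surj[OF const_pole_funs] by blast
      then have "c \<in> one_pole p" by (simp add: one_pole_def)
      moreover have "coeff (ev c y) (k y) \<noteq> 0" using c False by (simp add: k_def)
      ultimately show ?thesis by blast
    qed
    then obtain c where c: "c \<in> one_pole p" "coeff (ev c y) (k y) \<noteq> 0" by blast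
    have "maximal_convex_lsubgroup {b \<in> carrier ?A. coeff (ev b y) (k y) = 0} ?A"
      using c by (intro A.kernel_maximal[of _ c])
        (simp_all add: A.ev_mult[simplified] A.ev_join coeff_max_top deg)
    then show ?thesis by (simp add: N_def)
  qed
  have separated: "principal_convex ?A a = carrier ?A \<inter> \<Inter>(N ` {y. a \<in> N y})"
    if a: "a \<in> one_pole p" for a
  proof (intro equalityI subsetI)
    fix b assume "b \<in> principal_convex ?A a"
    then obtain n :: nat where b: "b \<in> one_pole p" and n: "\<And>x. \<bar>ev b x\<bar> \<le> of_nat n * \<bar>ev a x\<bar>"
      using a by (auto simp: A.principal_convex_eq)
    have "b \<in> N y" if "a \<in> N y" for y
    proof -
      have "degree (of_nat n * \<bar>ev a y\<bar>) \<le> k y"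
        using degree_mult_le[of "of_nat n" "\<bar>ev a y\<bar>"] deg[OF a, of y] by simp
      then have "coeff \<bar>ev b y\<bar> (k y) \<le> coeff (of_nat n * \<bar>ev a y\<bar>) (k y)"
        using n deg[OF b] by (intro coeff_mono_top) simp_all
      then show ?thesis
        using that a b by (simp add: N_def of_nat_poly coeff_abs_top deg)
    qed
    with b show "b \<in> carrier ?A \<inter> \<Inter>(N ` {y. a \<in> N y})" by simp
  next
    fix b assume b: "b \<in> carrier ?A \<inter> \<Inter>(N ` {y. a \<in> N y})"
    then have bA: "b \<in> one_pole p" and bN: "\<And>y. a \<in> N y \<Longrightarrow> b \<in> N y" by auto
    \<comment> \<open>A bound at \<open>x\<close> extends to a neighbourhood of \<open>x\<close>, hence to all points by compactness.\<close>
    have bound: "\<exists>n::nat. \<bar>ev b x\<bar> \<le> of_nat n * \<bar>ev a x\<bar>" for x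
    proof (cases "a \<in> N x")
      case False
      then have "coeff (ev a x) (k x) \<noteq> 0" using a by (simp add: N_def)
      then show ?thesis using archimedean_top deg a bA by blast
    next
      case True
      with bN have coeffs: "coeff (ev a x) (k x) = 0" "coeff (ev b x) (k x) = 0"
        by (auto simp: N_def)
      have degs: "degree (ev a x) = 0" "degree (ev b x) = 0"
        using coeffs deg[OF a, of x] deg[OF bA, of x]
        by (cases "x = p"; simp add: k_def degree_lowered)+
      show ?thesis
      proof (cases "ev a x = 0")
        case False
        then have "coeff (ev a x) 0 \<noteq> 0" using degs(1) by (metis leading_coeff_0_iff)
        then show ?thesis using archimedean_top degs by (metis order.refl)
      next
        case True
        \<comment> \<open>The delicate case is \<open>x = p\<close>, where \<open>N p\<close>
          controls the pole but not the value. As \<open>a\<close> vanishes near \<open>x\<close>,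
          so does \<open>b\<close> at nearby points other than \<open>p\<close>, and these determine
          the germ of \<open>b\<close>.\<close>
        have "\<forall>\<^sub>F n in sequentially. poly (ev b x) (int n) = poly 0 (int n)"
          using pole_funs_germ[OF ev_pole_funs[OF in_G[OF a]], of x]
            pole_funs_germ[OF ev_pole_funs[OF in_G[OF bA]], of x]
            eventually_gt_at_top[of "LEAST i. p i \<noteq> x i"]
        proof eventually_elim
          case (elim n)
          define y where "y = (\<lambda>i. if i = n then \<not> x n else x i)"
          have y: "splits_at x n y" by (simp add: splits_at_def y_def)
          \<comment> \<open>If \<open>y\<close> were \<open>p\<close>, the \<open>LEAST\<close>
            index would be \<open>n\<close> itself, against the lower bound on
            \<open>n\<close>.\<close>
          have "y \<noteq> p"
            using elim(3) Least_splits_at[OF y] by auto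
          then have "k y = 0" by (simp add: k_def)
          have "ev a y = 0" using elim(1) y True by simp
          then have "b \<in> N y" using a by (intro bN) (simp add: N_def)
          then have "coeff (ev b y) 0 = 0" using \<open>k y = 0\<close> by (simp add: N_def)
          then show ?case using elim(2) y by (simp add: of_int_poly)
        qed
        then have "ev b x = 0" by (rule poly_eqI_eventually)
        then show ?thesis by simp
      qed
    qed
    have "\<exists>n::nat. \<forall>y\<in>UNIV. \<bar>ev b y\<bar> \<le> of_nat n * \<bar>ev a y\<bar>"
    proof (rule cantor_compactness)
      fix x
      obtain n :: nat where n: "\<bar>ev b x\<bar> \<le> of_nat n * \<bar>ev a x\<bar>" using bound by blast
      have "(\<lambda>y. \<bar>ev b y\<bar>) \<in> pole_funs"
        using ev_pole_funs[OF lg_abs_closed[OF in_G[OF bA]]] in_G[OF bA] by (simp add: ev_abs)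
      moreover have "(\<lambda>y. of_nat n * \<bar>ev a y\<bar>) \<in> pole_funs"
        using ev_pole_funs[OF nat_pow_closed[OF lg_abs_closed[OF in_G[OF a]], of n]] in_G[OF a]
        by (simp add: ev_pow ev_abs lg_abs_closed)
      ultimately have "\<exists>m. \<forall>y. (\<forall>i<m. y i = x i) \<longrightarrow> \<bar>ev b y\<bar> \<le> of_nat n * \<bar>ev a y\<bar>"
        using n by (rule pole_funs_local_mono)
      then show "\<exists>m. \<exists>n::nat. \<forall>y\<in>{y. \<forall>i<m. y i = x i}. \<bar>ev b y\<bar> \<le> of_nat n * \<bar>ev a y\<bar>"
        by blast
    next
      fix U V
      assume "\<exists>n::nat. \<forall>y\<in>U. \<bar>ev b y\<bar> \<le> of_nat n * \<bar>ev a y\<bar>"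
        and "\<exists>n::nat. \<forall>y\<in>V. \<bar>ev b y\<bar> \<le> of_nat n * \<bar>ev a y\<bar>"
      then obtain n m :: nat where nm: "\<forall>y\<in>U. \<bar>ev b y\<bar> \<le> of_nat n * \<bar>ev a y\<bar>"
        "\<forall>y\<in>V. \<bar>ev b y\<bar> \<le> of_nat m * \<bar>ev a y\<bar>" by blast
      have "\<bar>ev b y\<bar> \<le> of_nat (n + m) * \<bar>ev a y\<bar>" if "y \<in> U \<union> V" for y
      proof -
        have "0 \<le> of_nat n * \<bar>ev a y\<bar>" "0 \<le> of_nat m * \<bar>ev a y\<bar>" by simp_all
        moreover have "\<bar>ev b y\<bar> \<le> of_nat n * \<bar>ev a y\<bar> \<or> \<bar>ev b y\<bar> \<le> of_nat m * \<bar>ev a y\<bar>"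
          using nm that by blast
        ultimately show ?thesis
          by (auto simp: distrib_right intro: add_increasing add_increasing2)
      qed
      then show "\<exists>n::nat. \<forall>y\<in>U \<union> V. \<bar>ev b y\<bar> \<le> of_nat n * \<bar>ev a y\<bar>" by blast
    qed
    with a bA show "b \<in> principal_convex ?A a"
      by (simp add: A.principal_convex_eq)
  qed
  have "\<exists>\<M>. (\<forall>M\<in>\<M>. maximal_convex_lsubgroup M ?A) \<and>
      principal_convex ?A a = carrier ?A \<inter> \<Inter>\<M>" if "a \<in> carrier ?A" for a
    using that N_maximal separated[of a] by (intro exI[of _ "N ` {y. a \<in> N y}"]) simp
  with A.l_group_axioms show ?thesis by (simp add: yosida_lgroup_def)
qed

text \<open>Stated for any convex l-subgroup above all \<open>one_pole p\<close>, so that the join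
  never has to be computed. The principal subgroup that fails is the one generated by the zero
  function.\<close>

lemma not_yosida:
  assumes H: "convex_lsubgroup H G" and poles: "\<And>p. one_pole p \<subseteq> H"
  shows "\<not> yosida_lgroup (G\<lparr>carrier := H\<rparr>)"
proof
  let ?H = "G\<lparr>carrier := H\<rparr>"
  assume yosida: "yosida_lgroup ?H"
  interpret H: fun_lgroup ?H ev
    using H by (rule sub_lgroup)
  have HG: "H \<subseteq> carrier G"
    using H by (simp add: convex_lsubgroup_def subgroup.subset)
  obtain u where u: "u \<in> carrier G" "ev u = (\<lambda>x. of_int 1)"
    using ev_surj[OF const_pole_funs] by blast
  \<comment> \<open>The point \<open>undefined\<close> is arbitrary: a constant has no poles and
    lies in every \<open>one_pole p\<close>.\<close>
  then have uH: "u \<in> H"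
    using poles[of undefined] by (auto simp: one_pole_def)
  have oneH: "\<one> \<in> H" using H.unit_closed by simp
  have "u \<notin> principal_convex ?H \<one>"
    using u oneH by (simp add: H.principal_convex_eq ev_one)
  moreover obtain \<M> where "\<forall>M\<in>\<M>. maximal_convex_lsubgroup M ?H"
    "principal_convex ?H \<one> = carrier ?H \<inter> \<Inter>\<M>"
    using yosida oneH unfolding yosida_lgroup_def by force
  ultimately obtain M where M: "maximal_convex_lsubgroup M ?H" and uM: "u \<notin> M"
    using uH by auto
  then have convex_M: "convex_lsubgroup M ?H"
    by (simp add: maximal_convex_lsubgroup_def)
  interpret M: subgroup M ?H
    using convex_M by (simp add: convex_lsubgroup_def)
  have MH: "M \<subseteq> H" using M.subset by simp
  have M_join: "lg_join ?H a b \<in> M" if "a \<in> M" "b \<in> M" for a b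
    using convex_M that unfolding convex_lsubgroup_def by blast
  have M_sandwich: "b \<in> M"
    if "a \<in> M" "c \<in> M" "b \<in> carrier ?H" "a \<preceq>\<^bsub>?H\<^esub> b" "b \<preceq>\<^bsub>?H\<^esub> c" for a b c
    using convex_M that unfolding convex_lsubgroup_def by blast
  \<comment> \<open>Otherwise some absolute value from \<open>M\<close> is at least 1 near each
    point; finitely many of them join to an element above \<open>u\<close>, and convexity forces
    \<open>u\<close> into \<open>M\<close>.\<close>
  have "\<exists>x. \<forall>m\<in>M. ev m x = 0"
  proof (rule ccontr)
    assume no_zero: "\<nexists>x. \<forall>m\<in>M. ev m x = 0"
    have "\<exists>m\<in>M. \<forall>y\<in>UNIV. 1 \<le> ev m y"
    proof (rule cantor_compactness)
      fix x
      obtain m where m: "m \<in> M" "ev m x \<noteq> 0" using no_zero by blast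
      let ?m = "lg_abs ?H m"
      have "?m \<in> M"
        unfolding lg_abs_def using m by (intro M_join M.m_inv_closed)
      have mH: "m \<in> H" using m MH by blast
      then have ev_m: "ev ?m = (\<lambda>x. \<bar>ev m x\<bar>)" using H.ev_abs by simp
      have "ev ?m \<in> pole_funs" using \<open>?m \<in> M\<close> MH HG ev_pole_funs by blast
      then have "\<exists>n. \<forall>y. (\<forall>i<n. y i = x i) \<longrightarrow> of_int 1 \<le> ev ?m y"
        using m(2) by (intro pole_funs_local_mono const_pole_funs) (simp_all add: ev_m one_le_abs_poly)
      then obtain n where "\<forall>y\<in>{y. \<forall>i<n. y i = x i}. 1 \<le> ev ?m y" by auto
      with \<open>?m \<in> M\<close> show "\<exists>n. \<exists>m\<in>M. \<forall>y\<in>{y. \<forall>i<n. y i = x i}. 1 \<le> ev m y"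
        by blast
    next
      fix U V
      assume "\<exists>m\<in>M. \<forall>y\<in>U. 1 \<le> ev m y" "\<exists>m\<in>M. \<forall>y\<in>V. 1 \<le> ev m y"
      then obtain l m where lm: "l \<in> M" "m \<in> M" "\<forall>y\<in>U. 1 \<le> ev l y" "\<forall>y\<in>V. 1 \<le> ev m y"
        by blast
      then have "l \<in> carrier ?H" "m \<in> carrier ?H" using MH by auto
      then have "ev (lg_join ?H l m) = (\<lambda>x. max (ev l x) (ev m x))" by (rule H.ev_join)
      with lm M_join show "\<exists>m\<in>M. \<forall>y\<in>U \<union> V. 1 \<le> ev m y"
        by (intro bexI[of _ "lg_join ?H l m"]) (auto simp: le_max_iff_disj)
    qed
    then obtain m where m: "m \<in> M" "\<And>y. 1 \<le> ev m y" by blast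
    have "\<one> \<preceq> u" "u \<preceq> m"
      using m u MH HG by (auto simp: leq_iff ev_one subset_iff)
    moreover have "\<one> \<in> M" using M.one_closed by simp
    ultimately have "u \<in> M"
      using m(1) uH by (intro M_sandwich[of \<one> m u]) simp_all
    with uM show False by blast
  qed
  then obtain x where x: "\<And>m. m \<in> M \<Longrightarrow> ev m x = 0" by blast
  \<comment> \<open>Strictly between \<open>M\<close> and \<open>H\<close>: it contains
    \<open>u\<close>, but not the pole at \<open>x\<close>.\<close>
  define N where "N = {a \<in> H. degree (ev a x) = 0}"
  have "convex_lsubgroup N ?H"
  proof (rule H.convex_lsubgroupI)
    show "a \<otimes>\<^bsub>?H\<^esub> inv\<^bsub>?H\<^esub> b \<in> N" if "a \<in> N" "b \<in> N" for a b
      using that degree_diff_le[of "ev a x" 0 "ev b x"] H.mult_closed[of a "inv\<^bsub>?H\<^esub> b"] H.inv_closed[of b]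
        H.ev_mult[of a "inv\<^bsub>?H\<^esub> b"] H.ev_inv[of b]
      by (simp add: N_def)
    show "b \<in> N" if "a \<in> N" "b \<in> carrier ?H" "\<And>x. \<bar>ev b x\<bar> \<le> \<bar>ev a x\<bar>" for a b
      using that degree_mono_abs[of "ev b x" "ev a x"] by (simp add: N_def)
  qed (auto simp: N_def oneH ev_one)
  moreover have "M \<subseteq> N" using MH x by (auto simp: N_def)
  moreover have "u \<in> N" using u uH by (simp add: N_def)
  moreover have "N \<noteq> H"
  proof -
    obtain c where c: "c \<in> carrier G" "ev c = pole x"
      using ev_surj[OF pole_pole_funs] by blast
    then have "c \<in> H" using poles[of x] by (auto simp: one_pole_def degree_pole)
    moreover have "c \<notin> N" using c by (simp add: N_def pole_def)
    ultimately show ?thesis by blast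
  qed
  ultimately show False
    using M uM unfolding maximal_convex_lsubgroup_def by auto
qed

end

section \<open>Realising the example inside the given type\<close>

lemma pole_lgroup_exists:
  assumes "(UNIV :: real set) \<lesssim> (UNIV :: 'a set)"
  obtains G :: "'a lgroup" and ev where "pole_lgroup G ev"
proof -
  obtain \<phi> :: "((nat \<Rightarrow> bool) \<Rightarrow> int poly) \<Rightarrow> 'a" where \<phi>: "inj_on \<phi> pole_funs"
    using lepoll_trans[OF pole_funs_lepoll assms] by (auto simp: lepoll_def)
  \<comment> \<open>Decoding inverts \<phi> on the image of \<open>pole_funs\<close>, which becomes
    the carrier; all operations are transported along it.\<close>
  define ev where "ev = inv_into pole_funs \<phi>"
  define G :: "'a lgroup" where
    "G = \<lparr>carrier = \<phi> ` pole_funs, monoid.mult = (\<lambda>a b. \<phi> (\<lambda>x. ev a x + ev b x)), one = \<phi> (\<lambda>x. 0),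
      leq = (\<lambda>a b. \<forall>x. ev a x \<le> ev b x)\<rparr>"
  have ev_\<phi>: "ev (\<phi> g) = g" if "g \<in> pole_funs" for g
    using \<phi> that by (simp add: ev_def)
  have zero: "(\<lambda>x. 0) \<in> pole_funs" using const_pole_funs[of 0] by simp
  have "pole_lgroup G ev"
  proof (intro pole_lgroup.intro fun_lgroup.intro pole_lgroup_axioms.intro)
    show "ev ` carrier G = pole_funs" by (auto simp: G_def ev_\<phi> image_image)
  qed (auto simp: G_def ev_\<phi> zero add_pole_funs uminus_pole_funs max_pole_funs)
  then show thesis by (rule that)
qed

theorem mainTheorem10:
  assumes "(UNIV :: real set) \<lesssim> (UNIV :: 'a set)"
  shows "\<not> radical_class (yosida_class :: 'a lgroup set)"
proof
  assume radical: "radical_class (yosida_class :: 'a lgroup set)"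
  obtain G :: "'a lgroup" and ev where "pole_lgroup G ev"
    using pole_lgroup_exists[OF assms] by blast
  then interpret pole_lgroup G ev .
  let ?\<A> = "range one_pole"
  have "\<forall>A\<in>?\<A>. convex_lsubgroup A G \<and> G\<lparr>carrier := A\<rparr> \<in> yosida_class"
    by (simp add: convex_one_pole yosida_one_pole yosida_class_def)
  with radical l_group_axioms have "G\<lparr>carrier := \<Squnion>\<^bsub>convex_lattice G\<^esub> ?\<A>\<rparr> \<in> yosida_class"
    unfolding radical_class_def by blast
  moreover have "\<not> yosida_lgroup (G\<lparr>carrier := \<Squnion>\<^bsub>convex_lattice G\<^esub> ?\<A>\<rparr>)"
    by (intro not_yosida convex_join) (auto simp: convex_one_pole)
  ultimately show False by (simp add: yosida_class_def)
qed

end
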